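(* Let $G_1,G_2,G_3$ be finite groups such that $G_1\times G_2\times G_3$ is not a $p$-group (for any prime $p$). Then the difference graph $D(G_1\times G_2\times G_3)$ is connected.
   Context: For a group $G$, the power graph $\mathsf{Pow}(G)$ has vertex set $G$, with distinct $a,b$ adjacent iff $a\in\langle b\rangle$ or $b\in\langle a\rangle$. The enhanced power graph $\mathsf{EPow}(G)$ has vertex set $G$, with distinct $a,b$ adjacent iff $\langle a,b\rangle$ is cyclic. The difference graph $D(G)$ is the graph $\mathsf{EPow}(G)-\mathsf{Pow}(G)$ with all isolated vertices removed; thus $x\sim y$ in $D(G)$ iff $\langle x,y\rangle$ is cyclic, $x\notin\langle y\rangle$ and $y\notin\langle x\rangle$.
   Formalization: The groups G_1, G_2, G_3 are additionally assumed nontrivial; without this the claim fails, e.g. for S_3 × S_3 × 1, whose difference graph has two components. *)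

theory Defs
  imports
    "HOL-Algebra.Elementary_Groups"
    "HOL-Computational_Algebra.Primes"
    "Graph_Theory.Graph_Theory"
begin

text \<open>
  A simple graph is represented as a \<^typ>\<open>'a pair_pre_digraph\<close> whose set of arcs is symmetric
  and irreflexive; each edge is present as two opposite arcs.
\<close>

definition power_graph :: "('a, 'm) monoid_scheme \<Rightarrow> 'a pair_pre_digraph" where
  "power_graph G =
     \<lparr> pverts = carrier G,
       parcs = {(a, b). a \<in> carrier G \<and> b \<in> carrier G \<and> a \<noteq> b \<and>
                        (a \<in> generate G {b} \<or> b \<in> generate G {a})} \<rparr>"

definition enhanced_power_graph :: "('a, 'm) monoid_scheme \<Rightarrow> 'a pair_pre_digraph" where
  "enhanced_power_graph G =
     \<lparr> pverts = carrier G,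
       parcs = {(a, b). a \<in> carrier G \<and> b \<in> carrier G \<and> a \<noteq> b \<and>
                        cyclic_group (subgroup_generated G {a, b})} \<rparr>"

definition edge_difference ::
  "'a pair_pre_digraph \<Rightarrow> 'a pair_pre_digraph \<Rightarrow> 'a pair_pre_digraph" where
  "edge_difference H K = \<lparr> pverts = pverts H, parcs = parcs H - parcs K \<rparr>"

definition remove_isolated :: "'a pair_pre_digraph \<Rightarrow> 'a pair_pre_digraph" where
  "remove_isolated H =
     \<lparr> pverts = {v \<in> pverts H. \<exists>w. (v, w) \<in> parcs H \<or> (w, v) \<in> parcs H}, parcs = parcs H \<rparr>"

definition difference_graph :: "('a, 'm) monoid_scheme \<Rightarrow> 'a pair_pre_digraph" where
  "difference_graph G =
     remove_isolated (edge_difference (enhanced_power_graph G) (power_graph G))"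

text \<open>This is only meant for finite groups. The trivial group is a \<open>p\<close>-group for every \<open>p\<close>.\<close>

definition p_group :: "nat \<Rightarrow> ('a, 'm) monoid_scheme \<Rightarrow> bool" where
  "p_group p G \<longleftrightarrow> group G \<and> (\<exists>n. order G = p ^ n)"

lemma parcs_difference_graph:
  assumes "group G"
  shows "(x, y) \<in> parcs (difference_graph G) \<longleftrightarrow>
           x \<in> carrier G \<and> y \<in> carrier G \<and> cyclic_group (subgroup_generated G {x, y}) \<and>
           x \<notin> generate G {y} \<and> y \<notin> generate G {x}"
  by (auto simp: difference_graph_def remove_isolated_def edge_difference_def
      enhanced_power_graph_def power_graph_def intro: generate.incl)

lemma pverts_difference_graph:
  "x \<in> pverts (difference_graph G) \<longleftrightarrow> (\<exists>y. (x, y) \<in> parcs (difference_graph G))"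
  by (auto simp: difference_graph_def remove_isolated_def edge_difference_def
      enhanced_power_graph_def power_graph_def insert_commute)

lemma pair_graph_difference_graph:
  assumes "finite (carrier G)"
  shows "pair_graph (difference_graph G)"
proof
  show "finite (pverts (difference_graph G))"
    by (auto intro: finite_subset[OF _ assms] simp: difference_graph_def remove_isolated_def
        edge_difference_def enhanced_power_graph_def)
  show "finite (parcs (difference_graph G))"
    by (rule finite_subset[of _ "carrier G \<times> carrier G"])
      (auto simp: assms difference_graph_def remove_isolated_def edge_difference_def
        enhanced_power_graph_def)
qed (auto simp: symmetric_def sym_def difference_graph_def remove_isolated_def edge_difference_def
      enhanced_power_graph_def power_graph_def insert_commute)

end

theory Submission
  imports Defs "HOL-Algebra.Sylow" "HOL-Algebra.Multiplicative_Group"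
begin

text \<open>
  Commuting elements of distinct prime orders are adjacent in the difference graph, and every vertex
  is joined by a path to an end of such an edge. An element of prime order may be replaced by one of
  its coordinates, so only edges between elements supported on a single factor matter. Given such an
  edge, an element of prime order in a third factor commutes with both ends and differs in order
  from at least one of them. Hence every component meets all three factors, and any two components
  are joined in the same way.
\<close>

section \<open>Cyclic subgroups and orders of elements\<close>

context group
begin

text \<open>If \<open>x\<close> and \<open>y\<close> are the powers of \<open>z\<close> with
  exponents \<open>a\<close> and \<open>b\<close>, then by Bezout the power of \<open>z\<close> with
  exponent \<open>gcd a b\<close> lies in the subgroup generated by \<open>x\<close> and
  \<open>y\<close>, and both are powers of it. Adjacency can thus be studied inside a common cyclic
  group.\<close>

lemma cyclic_pair_iff:
  assumes "x \<in> carrier G" "y \<in> carrier G"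
  shows "cyclic_group (subgroup_generated G {x, y}) \<longleftrightarrow>
           (\<exists>z\<in>carrier G. x \<in> generate G {z} \<and> y \<in> generate G {z})"
proof
  let ?S = "subgroup_generated G {x, y}"
  assume "cyclic_group ?S"
  moreover have "group ?S" by (rule group_subgroup_generated)
  ultimately obtain z where z: "z \<in> carrier ?S" "carrier ?S = range (\<lambda>n::int. z [^]\<^bsub>?S\<^esub> n)"
    using group.cyclic_group by blast
  have zG: "z \<in> carrier G"
    using z(1) carrier_subgroup_generated_subset by blast
  have "carrier ?S \<subseteq> generate G {z}"
    unfolding z(2) generate_pow[OF zG] using z(1) by (auto simp: int_pow_subgroup_generated)
  moreover have "x \<in> carrier ?S" "y \<in> carrier ?S"
    using assms by (auto simp: carrier_subgroup_generated intro: generate.incl)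
  ultimately show "\<exists>z\<in>carrier G. x \<in> generate G {z} \<and> y \<in> generate G {z}"
    using zG by blast
next
  assume "\<exists>z\<in>carrier G. x \<in> generate G {z} \<and> y \<in> generate G {z}"
  then obtain z a b where zG: "z \<in> carrier G"
    and x: "x = z [^] (a::int)" and y: "y = z [^] (b::int)"
    by (auto simp: generate_pow)
  obtain u v where uv: "u * a + v * b = gcd a b"
    using bezout_int by blast
  define w where "w = z [^] gcd a b"
  have wG: "w \<in> carrier G" using zG by (simp add: w_def)
  have "w = x [^] u \<otimes> y [^] v"
    using zG by (simp add: w_def x y int_pow_pow int_pow_mult mult.commute flip: uv)
  moreover have sub: "subgroup (generate G {x, y}) G"
    using assms by (intro generate_is_subgroup) auto
  moreover have "x \<in> generate G {x, y}" "y \<in> generate G {x, y}"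
    by (auto intro: generate.incl)
  ultimately have "w \<in> generate G {x, y}"
    by (simp add: subgroup.m_closed subgroup_int_pow_closed)
  moreover have "x = w [^] (a div gcd a b)" "y = w [^] (b div gcd a b)"
    using zG by (simp_all add: w_def x y int_pow_pow)
  then have "x \<in> generate G {w}" "y \<in> generate G {w}"
    by (auto simp: generate_pow[OF wG])
  ultimately have "generate G {x, y} = generate G {w}"
    using assms wG sub
    by (intro equalityI generate_subgroup_incl generate_is_subgroup) auto
  then have "subgroup_generated G {x, y} = subgroup_generated G {w}"
    using assms wG by (simp add: subgroup_generated_def)
  then show "cyclic_group (subgroup_generated G {x, y})"
    using cyclic_group_generated by simp
qed

lemma ord_dvd_ord_if_mem_generate:
  assumes "y \<in> carrier G" "x \<in> generate G {y}"
  shows "ord x dvd ord y"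
proof -
  obtain k where k: "x = y [^] (k::int)"
    using assms by (auto simp: generate_pow)
  have "x [^] ord y = (y [^] int (ord y)) [^] k"
    using assms(1) by (simp add: k int_pow_pow mult.commute flip: int_pow_int)
  also have "\<dots> = \<one>"
    using assms(1) by (simp add: int_pow_int)
  finally show ?thesis
    using assms(1) k by (simp add: pow_eq_id)
qed

text \<open>A finite cyclic group has only one subgroup of each order. This converse of
  \<open>ord_dvd_ord_if_mem_generate\<close> inside the cyclic group of \<open>z\<close> turns
  non-adjacency in the power graph into non-divisibility of orders.\<close>

lemma mem_generate_if_ord_dvd_ord:
  assumes "finite (carrier G)" "z \<in> carrier G"
    and "x \<in> generate G {z}" "y \<in> generate G {z}" and "ord x dvd ord y"
  shows "x \<in> generate G {y}"
proof -
  obtain a b where x: "x = z [^] (a::nat)" and y: "y = z [^] (b::nat)"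
    using assms generate_pow_on_finite_carrier[OF assms(1,2)] by auto
  define g where "g = gcd b (ord z)"
  have pos: "ord z > 0" using ord_ge_1[OF assms(1,2)] by simp
  have g: "g > 0" "g dvd b" "g dvd ord z" using pos by (auto simp: g_def)
  have "y [^] (ord z div g) = \<one>"
  proof -
    have "g * (ord z div g) dvd b * (ord z div g)"
      using g(2) by (rule mult_dvd_mono) simp
    then have "ord z dvd b * (ord z div g)"
      using g(3) by simp
    then show ?thesis
      using assms(2) by (simp add: y nat_pow_pow pow_eq_id)
  qed
  then have "ord y dvd ord z div g"
    using assms(2) by (simp add: y pow_eq_id)
  then have "x [^] (ord z div g) = \<one>"
    using assms(2,5) by (simp add: x pow_eq_id dvd_trans)
  then have "ord z dvd a * (ord z div g)"
    using assms(2) by (simp add: x nat_pow_pow pow_eq_id)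
  then have "g * (ord z div g) dvd a * (ord z div g)"
    using g by simp
  moreover have "ord z div g \<noteq> 0" using pos g(3) by (simp add: dvd_div_eq_0_iff)
  ultimately have "g dvd a"
    by simp
  then obtain t where t: "a = g * t" ..
  obtain u v where uv: "u * int b + v * int (ord z) = int g"
    unfolding g_def using bezout_int[of "int b" "int (ord z)"] by auto
  \<comment> \<open>The Bezout identity multiplied by \<open>t\<close> exhibits \<open>a\<close> as
    a multiple of \<open>b\<close> modulo \<open>ord z\<close>.\<close>
  have "int a = int b * (u * int t) + int (ord z) * (v * int t)"
    unfolding t of_nat_mult by (simp add: algebra_simps flip: uv)
  then have "x = (z [^] int b) [^] (u * int t) \<otimes> (z [^] int (ord z)) [^] (v * int t)"
    using assms(2) by (simp add: x int_pow_pow int_pow_mult flip: int_pow_int)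
  then have "x = y [^] (u * int t)"
    using assms(2) by (simp add: y int_pow_int)
  then show ?thesis
    using assms(2) by (auto simp: y generate_pow)
qed

text \<open>Raising the product to the power \<open>ord y\<close> removes \<open>y\<close>, and
  \<open>x\<close> can be recovered from its power because \<open>ord y\<close> is invertible modulo
  \<open>ord x\<close>.\<close>

lemma mem_generate_mult_if_coprime:
  assumes "x \<in> carrier G" "y \<in> carrier G" "x \<otimes> y = y \<otimes> x" "coprime (ord x) (ord y)"
  shows "x \<in> generate G {x \<otimes> y}"
proof -
  obtain u v where uv: "u * int (ord y) + v * int (ord x) = 1"
    using bezout_int[of "int (ord y)" "int (ord x)"] assms(4)
    by (auto simp: coprime_commute)
  have "x [^] (1::int) = (x [^] int (ord y)) [^] u \<otimes> (x [^] int (ord x)) [^] v"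
    using assms(1) by (simp only: int_pow_pow flip: uv int_pow_mult)
      (simp add: mult.commute)
  then have "x = (x [^] int (ord y)) [^] u"
    using assms(1) by (simp add: int_pow_int)
  also have "x [^] int (ord y) = (x \<otimes> y) [^] int (ord y)"
    using assms by (simp add: int_pow_int pow_mult_distrib)
  finally have "x = (x \<otimes> y) [^] (int (ord y) * u)"
    using assms(1,2) by (simp add: int_pow_pow)
  then show ?thesis
    using assms(1,2) by (auto simp: generate_pow)
qed

lemma ord_pow_ord_div:
  assumes "finite (carrier G)" "x \<in> carrier G" "d dvd ord x"
  shows "ord (x [^] (ord x div d)) = d"
proof -
  have nz: "ord x \<noteq> 0" using ord_ge_1[OF assms(1,2)] by simp
  then have "ord x div d \<noteq> 0" using assms(3) by (simp add: dvd_div_eq_0_iff)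
  then have "ord (x [^] (ord x div d)) = ord x div (ord x div d)"
    using assms(2,3) by (intro ord_pow) (metis dvd_div_mult_self dvd_triv_left)+
  also have "\<dots> = d"
    using nz assms(3) by (auto elim!: dvdE)
  finally show ?thesis .
qed

text \<open>Sylow's theorem with exponent 1 gives a subgroup of order \<open>p\<close>; by Lagrange
  every element of it other than the identity has order \<open>p\<close>.\<close>

lemma cauchy_theorem:
  assumes "finite (carrier G)" "Factorial_Ring.prime p" "p dvd order G"
  shows "\<exists>x\<in>carrier G. ord x = p"
proof -
  obtain m where "order G = p ^ 1 * m" using assms(3) by auto
  then obtain H where H: "subgroup H G" "card H = p"
    using sylow_thm[OF assms(2) is_group _ assms(1)] by fastforce
  have "finite H" "1 < card H"
    using H assms(1) prime_gt_1_nat[OF assms(2)] by (auto intro: finite_subset dest: subgroup.subset)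
  then obtain x where x: "x \<in> H" "x \<noteq> \<one>"
    by (metis card_le_Suc0_iff_eq One_nat_def subgroup.one_closed[OF H(1)] not_less)
  have xG: "x \<in> carrier G" using H(1) x(1) by (rule subgroup.mem_carrier)
  interpret S: group "G\<lparr>carrier := H\<rparr>" using H(1) by (rule subgroup_imp_group)
  have "x [^]\<^bsub>G\<lparr>carrier := H\<rparr>\<^esub> order (G\<lparr>carrier := H\<rparr>) = \<one>\<^bsub>G\<lparr>carrier := H\<rparr>\<^esub>"
    using S.pow_order_eq_1[of x] x(1) by simp
  then have "x [^] p = \<one>"
    using H(2) by (simp add: order_def nat_pow_def)
  then have "ord x dvd p" using xG by (simp add: pow_eq_id)
  moreover have "ord x \<noteq> 1" using xG x(2) ord_eq_1 by blast
  ultimately show ?thesis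
    using xG assms(2) prime_nat_iff by blast
qed

section \<open>Edges of the difference graph\<close>

text \<open>The product \<open>x \<otimes> y\<close> generates both elements, and coprime orders
  different from 1 do not divide each other.\<close>

lemma difference_graph_arc_if_coprime:
  assumes "x \<in> carrier G" "y \<in> carrier G" "x \<otimes> y = y \<otimes> x"
    and "coprime (ord x) (ord y)" "x \<noteq> \<one>" "y \<noteq> \<one>"
  shows "(x, y) \<in> parcs (difference_graph G)"
proof -
  have "x \<in> generate G {x \<otimes> y}"
    using assms by (intro mem_generate_mult_if_coprime)
  moreover have "y \<in> generate G {x \<otimes> y}"
    using mem_generate_mult_if_coprime[of y x] assms by (simp add: coprime_commute)
  ultimately have "cyclic_group (subgroup_generated G {x, y})"
    using assms(1,2) cyclic_pair_iff by blast
  moreover have "\<not> ord x dvd ord y" "\<not> ord y dvd ord x"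
    using assms ord_eq_1 by (metis coprime_absorb_left is_unit_gcd_iff nat_dvd_1_iff_1,
        metis coprime_absorb_right nat_dvd_1_iff_1)
  ultimately show ?thesis
    using assms(1,2) by (auto simp: parcs_difference_graph[OF is_group] dest: ord_dvd_ord_if_mem_generate)
qed

lemma sym_parcs_difference_graph: "sym (parcs (difference_graph G))"
  by (rule symI) (simp add: parcs_difference_graph[OF is_group] insert_commute)

text \<open>Requiring two distinct primes has the effect that any third prime order differs from at
  least one of them, which is what allows such edges to be extended.\<close>

definition prime_edge :: "'a \<Rightarrow> 'a \<Rightarrow> bool" where
  "prime_edge u v \<longleftrightarrow> u \<in> carrier G \<and> v \<in> carrier G \<and> u \<otimes> v = v \<otimes> u \<and>
     Factorial_Ring.prime (ord u) \<and> Factorial_Ring.prime (ord v) \<and> ord u \<noteq> ord v"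

lemma prime_edge_sym: "prime_edge u v \<Longrightarrow> prime_edge v u"
  unfolding prime_edge_def by metis

lemma difference_graph_arc_if_prime_edge:
  assumes "prime_edge u v"
  shows "(u, v) \<in> parcs (difference_graph G)"
proof (rule difference_graph_arc_if_coprime)
  show "coprime (ord u) (ord v)"
    using assms unfolding prime_edge_def by (blast intro: primes_coprime)
  show "u \<noteq> \<one>" "v \<noteq> \<one>"
    using assms unfolding prime_edge_def by (metis ord_id not_prime_1)+
qed (use assms in \<open>unfold prime_edge_def, blast+\<close>)

text \<open>
  If \<open>q\<close> and \<open>p\<close> are primes witnessing that neither of the orders of \<open>x\<close> and \<open>y\<close> divides the other,
  then \<open>x\<close>, the \<open>p\<close>-part of \<open>y\<close>, and a power of \<open>x\<close> of order \<open>q\<close> form a path.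
\<close>

lemma difference_graph_arc_reaches_prime_edge:
  assumes fin: "finite (carrier G)" and arc: "(x, y) \<in> parcs (difference_graph G)"
  shows "\<exists>w v. prime_edge w v \<and> (x, w) \<in> (parcs (difference_graph G))\<^sup>*"
proof -
  have xG: "x \<in> carrier G" and yG: "y \<in> carrier G"
    and nxy: "x \<notin> generate G {y}" "y \<notin> generate G {x}"
    and "cyclic_group (subgroup_generated G {x, y})"
    using arc by (simp_all add: parcs_difference_graph[OF is_group])
  then obtain z where zG: "z \<in> carrier G" and xz: "x \<in> generate G {z}" and yz: "y \<in> generate G {z}"
    using cyclic_pair_iff by blast
  have nz: "ord x \<noteq> 0" "ord y \<noteq> 0"
    using ord_ge_1[OF fin] xG yG by fastforce+
  \<comment> \<open>Within the cyclic group of \<open>z\<close>, divisibility of orders would give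
    membership, so each order has some prime to a higher power than the other does.\<close>
  have "\<not> ord x dvd ord y" "\<not> ord y dvd ord x"
    using mem_generate_if_ord_dvd_ord[OF fin zG] xz yz nxy by blast+
  then obtain p q where p: "Factorial_Ring.prime p" "multiplicity p (ord x) < multiplicity p (ord y)"
    and q: "Factorial_Ring.prime q" "multiplicity q (ord y) < multiplicity q (ord x)"
    using nz multiplicity_le_imp_dvd by (metis not_le)
  then have pq: "p \<noteq> q" by auto
  \<comment> \<open>The full \<open>p\<close>-part is taken because \<open>p\<close> itself may
    divide \<open>ord x\<close>, whereas \<open>p ^ k\<close> cannot. So \<open>y'\<close> is a
    neighbour of \<open>x\<close>, while its power \<open>v\<close> of order \<open>p\<close> need
    not be.\<close>
  define k where "k = multiplicity p (ord y)"
  have k: "k > 0" "p ^ k dvd ord y" "\<not> p ^ k dvd ord x"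
    using p(2) nz power_dvd_iff_le_multiplicity[of "ord x" p k] prime_gt_1_nat[OF p(1)]
    by (auto simp: k_def multiplicity_dvd)
  have qx: "q dvd ord x"
    using q(2) by (intro ccontr[of "q dvd ord x"]) (simp add: not_dvd_imp_multiplicity_0)
  define y' where "y' = y [^] (ord y div p ^ k)"
  have y'G: "y' \<in> carrier G" using yG by (simp add: y'_def)
  have ord_y': "ord y' = p ^ k"
    unfolding y'_def using fin yG k(2) by (rule ord_pow_ord_div)
  define w where "w = x [^] (ord x div q)"
  have wG: "w \<in> carrier G" using xG by (simp add: w_def)
  have ord_w: "ord w = q"
    unfolding w_def using fin xG qx by (rule ord_pow_ord_div)
  define v where "v = y' [^] (ord y' div p)"
  have vG: "v \<in> carrier G" using y'G by (simp add: v_def)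
  have ord_v: "ord v = p"
    unfolding v_def using fin y'G by (rule ord_pow_ord_div) (use k ord_y' in simp)
  have pow_mem: "a [^] (n::nat) \<in> generate G {z}" if "a \<in> generate G {z}" for a n
    using that zG subgroup_int_pow_closed[OF generate_is_subgroup, of "{z}" a "int n"]
    by (simp add: int_pow_int)
  have mem: "y' \<in> generate G {z}" "w \<in> generate G {z}" "v \<in> generate G {z}"
    using pow_mem xz yz by (simp_all add: y'_def w_def v_def)
  have comm: "a \<otimes> b = b \<otimes> a" if "a \<in> generate G {z}" "b \<in> generate G {z}" for a b
    using that zG by (auto simp: generate_pow int_pow_mult[symmetric] add.commute)
  have "(x, y') \<in> parcs (difference_graph G)"
  proof -
    have "cyclic_group (subgroup_generated G {x, y'})"
      using cyclic_pair_iff[OF xG y'G] zG xz mem(1) by blast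
    moreover have "y' \<notin> generate G {x}"
      using ord_dvd_ord_if_mem_generate[OF xG, of y'] k(3) by (auto simp: ord_y')
    moreover have "x \<notin> generate G {y'}"
    proof
      assume "x \<in> generate G {y'}"
      then have "q dvd p ^ k"
        using ord_dvd_ord_if_mem_generate[OF y'G] qx ord_y' by (metis dvd_trans)
      then show False
        using prime_dvd_power[OF q(1)] primes_dvd_imp_eq[OF q(1) p(1)] pq by blast
    qed
    ultimately show ?thesis
      using xG y'G by (simp add: parcs_difference_graph[OF is_group])
  qed
  moreover have "(y', w) \<in> parcs (difference_graph G)"
  proof (rule difference_graph_arc_if_coprime)
    show "coprime (ord y') (ord w)"
      using pq p(1) q(1) by (simp add: ord_y' ord_w primes_coprime)
    show "y' \<noteq> \<one>"
      using ord_y' one_less_power[OF prime_gt_1_nat[OF p(1)] k(1)] by auto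
    show "w \<noteq> \<one>" using ord_w q(1) by auto
  qed (use y'G wG comm[OF mem(1,2)] in \<open>simp_all only:\<close>)
  moreover have "prime_edge w v"
    using wG vG comm[OF mem(2,3)] p(1) q(1) pq by (simp add: prime_edge_def ord_w ord_v)
  ultimately show ?thesis
    by (intro exI[of _ w] exI[of _ v]) (auto intro: rtrancl_trans)
qed

end

section \<open>Finite groups with three commuting factors\<close>

text \<open>The maps \<open>P i\<close> model the coordinate projections of a direct product, viewed
  as endomorphisms of the whole group. Factors of different types become one indexed family, so the
  argument can treat them symmetrically.\<close>

locale three_commuting_factors = group G for G (structure) +
  fixes P :: "nat \<Rightarrow> 'a \<Rightarrow> 'a"
  assumes finite_carrier: "finite (carrier G)"
    and P_hom: "i < 3 \<Longrightarrow> P i \<in> hom G G"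
    and P_commute: "\<lbrakk>i < 3; j < 3; i \<noteq> j; x \<in> carrier G; y \<in> carrier G\<rbrakk> \<Longrightarrow>
      P i x \<otimes> P j y = P j y \<otimes> P i x"
    and P_centralize: "\<lbrakk>i < 3; x \<in> carrier G; y \<in> carrier G; x \<otimes> y = y \<otimes> x\<rbrakk> \<Longrightarrow>
      x \<otimes> P i y = P i y \<otimes> x"
    and P_faithful: "\<lbrakk>x \<in> carrier G; \<And>i. i < 3 \<Longrightarrow> P i x = \<one>\<rbrakk> \<Longrightarrow> x = \<one>"
    and P_nontrivial: "i < 3 \<Longrightarrow> \<exists>x\<in>carrier G. P i x \<noteq> \<one>"
begin

lemma P_closed: "i < 3 \<Longrightarrow> x \<in> carrier G \<Longrightarrow> P i x \<in> carrier G"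
  by (rule hom_in_carrier[OF P_hom])

lemma P_pow: "i < 3 \<Longrightarrow> x \<in> carrier G \<Longrightarrow> P i (x [^] (n::nat)) = P i x [^] n"
  by (rule hom_nat_pow[OF P_hom _ is_group is_group])

text \<open>The order of each projection divides the prime \<open>ord u\<close>, so it is 1 or
  \<open>ord u\<close>; by \<open>P_faithful\<close> the projections are not all trivial.\<close>

lemma ord_P:
  assumes "u \<in> carrier G" "Factorial_Ring.prime (ord u)"
  obtains i where "i < 3" "ord (P i u) = ord u"
proof -
  have "u \<noteq> \<one>" using assms(2) by auto
  then obtain i where i: "i < 3" "P i u \<noteq> \<one>"
    using P_faithful assms(1) by blast
  have "P i u [^] ord u = P i \<one>"
    using P_pow[OF i(1) assms(1), of "ord u"] assms(1) by simp
  also have "\<dots> = \<one>"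
    using P_hom[OF i(1)] hom_one is_group by blast
  finally have "ord (P i u) dvd ord u"
    using P_closed[OF i(1) assms(1)] by (simp add: pow_eq_id)
  moreover have "ord (P i u) \<noteq> 1"
    using i(2) P_closed[OF i(1) assms(1)] ord_eq_1 by blast
  ultimately show ?thesis
    using that i(1) assms(2) prime_nat_iff by blast
qed

text \<open>Some projection of \<open>u\<close> keeps its prime order, and by
  \<open>P_centralize\<close> it still commutes with \<open>w\<close>.\<close>

lemma prime_edge_to_factor:
  assumes "prime_edge w u"
  obtains i where "i < 3" "prime_edge w (P i u)"
proof -
  have u: "u \<in> carrier G" "Factorial_Ring.prime (ord u)" using assms by (auto simp: prime_edge_def)
  then obtain i where "i < 3" "ord (P i u) = ord u"
    using ord_P by blast
  then show ?thesis
    using that[of i] assms P_closed[of i u] P_centralize[of i w u] unfolding prime_edge_def by metis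
qed

lemma exists_prime_ord_in_factor:
  assumes "i < 3"
  obtains s where "s \<in> carrier G" "Factorial_Ring.prime (ord (P i s))"
proof -
  obtain x where x: "x \<in> carrier G" "P i x \<noteq> \<one>"
    using P_nontrivial assms by blast
  have PxG: "P i x \<in> carrier G" using P_closed assms x(1) by blast
  then have "ord (P i x) \<noteq> 1" using x(2) ord_eq_1 by blast
  then obtain r where r: "Factorial_Ring.prime r" "r dvd ord (P i x)"
    using prime_factor_nat by blast
  \<comment> \<open>The power is taken before projecting, so that the element found is visibly in
    the image of \<open>P i\<close>.\<close>
  then have "ord (P i (x [^] (ord (P i x) div r))) = r"
    using ord_pow_ord_div[OF finite_carrier PxG r(2)] P_pow[OF assms x(1)] by simp
  then show ?thesis
    using that[of "x [^] (ord (P i x) div r)"] x(1) r(1) by simp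
qed

text \<open>An element of a factor other than \<open>i\<close> and \<open>j\<close> commutes with
  both ends, and its order can agree with at most one of their two distinct orders.\<close>

lemma third_factor_extends_prime_edge:
  assumes "i < 3" "j < 3" "k < 3" "k \<noteq> i" "k \<noteq> j" "a \<in> carrier G" "b \<in> carrier G" "s \<in> carrier G"
    and "prime_edge (P i a) (P j b)" "Factorial_Ring.prime (ord (P k s))"
  shows "prime_edge (P i a) (P k s) \<or> prime_edge (P j b) (P k s)"
proof -
  have "P i a \<otimes> P k s = P k s \<otimes> P i a" "P j b \<otimes> P k s = P k s \<otimes> P j b"
    using assms P_commute[of i k a s] P_commute[of j k b s] by blast+
  then show ?thesis
    using assms P_closed[of k s] unfolding prime_edge_def by metis
qed

section \<open>Paths between vertices\<close>

abbreviation R :: "('a \<times> 'a) set" where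
  "R \<equiv> (parcs (difference_graph G))\<^sup>*"

lemma R_sym: "(x, y) \<in> R \<Longrightarrow> (y, x) \<in> R"
  using sym_rtrancl[OF sym_parcs_difference_graph] by (rule symD)

lemma R_trans: "(x, y) \<in> R \<Longrightarrow> (y, z) \<in> R \<Longrightarrow> (x, z) \<in> R"
  by (rule rtrancl_trans)

lemma prime_edge_R: "prime_edge x y \<Longrightarrow> (x, y) \<in> R"
  by (intro r_into_rtrancl difference_graph_arc_if_prime_edge)

text \<open>If \<open>k\<close> is \<open>i\<close> or \<open>j\<close>, an end of the edge already
  serves; otherwise the edge is extended into the third factor, possibly through its other
  end.\<close>

lemma prime_edge_reaches_every_factor:
  assumes "i < 3" "j < 3" "k < 3" "a \<in> carrier G" "b \<in> carrier G" "prime_edge (P i a) (P j b)"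
  obtains s where "s \<in> carrier G" "Factorial_Ring.prime (ord (P k s))" "(P i a, P k s) \<in> R"
proof (cases "k = i \<or> k = j")
  case True
  then show ?thesis
    using that[of a] that[of b] assms prime_edge_R[OF assms(6)] unfolding prime_edge_def by blast
next
  case False
  obtain s where s: "s \<in> carrier G" "Factorial_Ring.prime (ord (P k s))"
    using exists_prime_ord_in_factor[OF assms(3)] by blast
  then have "prime_edge (P i a) (P k s) \<or> prime_edge (P j b) (P k s)"
    using third_factor_extends_prime_edge[of i j k a b s] assms False by auto
  then have "(P i a, P k s) \<in> R"
    using prime_edge_R assms(6) R_trans by blast
  then show ?thesis
    using that s by blast
qed

lemma arc_reaches_factor_edge:
  assumes "(x, y) \<in> parcs (difference_graph G)"
  obtains i j a b where "i < 3" "j < 3" "a \<in> carrier G" "b \<in> carrier G"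
    "prime_edge (P i a) (P j b)" "(x, P i a) \<in> R"
proof -
  obtain w v where w: "prime_edge w v" "(x, w) \<in> R"
    using difference_graph_arc_reaches_prime_edge[OF finite_carrier assms] by blast
  then obtain i where i: "i < 3" "prime_edge w (P i v)"
    using prime_edge_to_factor by blast
  \<comment> \<open>The reversed edge is projected at its other end. The path from \<open>x\<close>
    then runs through \<open>w\<close> to \<open>P i v\<close>, which becomes the first end of the
    new edge.\<close>
  then obtain j where "j < 3" "prime_edge (P i v) (P j w)"
    using prime_edge_to_factor prime_edge_sym by blast
  moreover have "v \<in> carrier G" "w \<in> carrier G"
    using w(1) by (simp_all add: prime_edge_def)
  ultimately show ?thesis
    using that i w(2) prime_edge_R[OF i(2)] R_trans by blast
qed

lemma all_vertices_R:
  assumes "(x, x') \<in> parcs (difference_graph G)" "(y, y') \<in> parcs (difference_graph G)"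
  shows "(x, y) \<in> R"
proof -
  obtain i j a b where x: "i < 3" "j < 3" "a \<in> carrier G" "b \<in> carrier G"
    "prime_edge (P i a) (P j b)" "(x, P i a) \<in> R"
    using arc_reaches_factor_edge[OF assms(1)] by metis
  obtain i' j' a' b' where y: "i' < 3" "j' < 3" "a' \<in> carrier G" "b' \<in> carrier G"
    "prime_edge (P i' a') (P j' b')" "(y, P i' a') \<in> R"
    using arc_reaches_factor_edge[OF assms(2)] by metis
  \<comment> \<open>Only the factors of the first edge are avoided; \<open>k\<close> may be
    \<open>i'\<close> or \<open>j'\<close>. Hence \<open>s\<close> is found from the second edge,
    where any factor is reachable, and then attached to the first.\<close>
  have "\<exists>k<3. k \<noteq> i \<and> k \<noteq> j" by presburger
  then obtain k where k: "k < 3" "k \<noteq> i" "k \<noteq> j" by blast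
  obtain s where s: "s \<in> carrier G" "Factorial_Ring.prime (ord (P k s))" "(P i' a', P k s) \<in> R"
    using prime_edge_reaches_every_factor y k(1) by metis
  have "prime_edge (P i a) (P k s) \<or> prime_edge (P j b) (P k s)"
    using third_factor_extends_prime_edge x k s by blast
  then have "(P i a, P k s) \<in> R"
    using prime_edge_R x(5) R_trans by blast
  then show ?thesis
    using x(6) y(6) s(3) R_sym R_trans by meson
qed

section \<open>Existence of an edge and connectedness\<close>

text \<open>Connectedness includes that the vertex set is nonempty. Elements of two distinct prime
  orders, given by Cauchy's theorem, are moved into factors to obtain an edge.\<close>

lemma exists_arc:
  assumes "\<not> (\<exists>p. Factorial_Ring.prime p \<and> p_group p G)"
  shows "\<exists>x y. (x, y) \<in> parcs (difference_graph G)"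
proof -
  have not_pow: "order G \<noteq> p ^ n" if "Factorial_Ring.prime p" for p n
    using assms that is_group unfolding p_group_def by blast
  \<comment> \<open>Order 1 is the power of the prime 2 with exponent 0.\<close>
  then have "order G \<noteq> 1"
    using two_is_prime_nat power_0 by metis
  then obtain p where p: "Factorial_Ring.prime p" "p dvd order G"
    using prime_factor_nat by blast
  have "order G \<noteq> 0" "\<not> is_unit p"
    using finite_carrier order_gt_0_iff_finite p(1) not_prime_unit by auto
  \<comment> \<open>Here \<open>m\<close> is the part of the order prime to \<open>p\<close>. It is
    not 1, since the order is no power of \<open>p\<close>, and so it supplies a second
    prime.\<close>
  then obtain m where m: "order G = p ^ multiplicity p (order G) * m" "\<not> p dvd m"
    by (rule multiplicity_decompose')
  have "m \<noteq> 1"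
    using not_pow[OF p(1)] m(1) by (metis mult_1_right)
  then obtain q where q: "Factorial_Ring.prime q" "q dvd m"
    using prime_factor_nat by blast
  have pq: "p \<noteq> q" using m(2) q(2) by auto
  have "q dvd order G" using m(1) q(2) dvd_mult by metis
  then obtain x y where xy: "x \<in> carrier G" "ord x = p" "y \<in> carrier G" "ord y = q"
    using cauchy_theorem[OF finite_carrier] p q(1) by metis
  obtain i where i: "i < 3" "ord (P i x) = p"
    using ord_P xy p by metis
  obtain j where j: "j < 3" "ord (P j y) = q"
    using ord_P xy q by metis
  have closed: "P i x \<in> carrier G" "P j y \<in> carrier G"
    using P_closed i j xy by auto
  have "\<exists>u v. prime_edge u v"
  proof (cases "i = j")
    case False
    then have "prime_edge (P i x) (P j y)"
      using closed i j xy p(1) q(1) pq P_commute[of i j x y] by (simp add: prime_edge_def)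
    then show ?thesis by blast
  next
    \<comment> \<open>Within a single factor the two elements need not commute. An element of prime
      order in another factor commutes with both and differs in order from one of them.\<close>
    case True
    define k where "k = (if i = 0 then 1 else 0 :: nat)"
    have k: "k < 3" "k \<noteq> i" by (auto simp: k_def)
    obtain s where s: "s \<in> carrier G" "Factorial_Ring.prime (ord (P k s))"
      using exists_prime_ord_in_factor[OF k(1)] by blast
    have "P i x \<otimes> P k s = P k s \<otimes> P i x" "P j y \<otimes> P k s = P k s \<otimes> P j y"
      using P_commute[of i k x s] P_commute[of j k y s] i j k s xy True by auto
    moreover have "P k s \<in> carrier G" using P_closed k s by blast
    ultimately have "prime_edge (P i x) (P k s) \<or> prime_edge (P j y) (P k s)"
      using closed i(2) j(2) p(1) q(1) pq s(2) unfolding prime_edge_def by metis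
    then show ?thesis by blast
  qed
  then show ?thesis
    by (blast intro: difference_graph_arc_if_prime_edge)
qed

lemma connected_difference_graph:
  assumes "\<not> (\<exists>p. Factorial_Ring.prime p \<and> p_group p G)"
  shows "Digraph_Component.connected (with_proj (difference_graph G))"
proof -
  let ?D = "difference_graph G"
  interpret pair_graph ?D
    using finite_carrier by (rule pair_graph_difference_graph)
  have reach: "u \<rightarrow>\<^sup>*\<^bsub>with_proj ?D\<^esub> v" if "u \<in> pverts ?D" "v \<in> pverts ?D" "(u, v) \<in> R" for u v
    using that by (simp add: reachable_conv)
  \<comment> \<open>Connectedness of a digraph is strong connectedness of its symmetric closure, to
    which paths in the graph carry over.\<close>
  have "strongly_connected (with_proj (mk_symmetric (with_proj ?D)))"
  proof (rule strongly_connectedI)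
    show "verts (with_proj (mk_symmetric (with_proj ?D))) \<noteq> {}"
      using exists_arc[OF assms] pverts_difference_graph by fastforce
    fix u v
    assume "u \<in> verts (with_proj (mk_symmetric (with_proj ?D)))"
      and "v \<in> verts (with_proj (mk_symmetric (with_proj ?D)))"
    then have uv: "u \<in> pverts ?D" "v \<in> pverts ?D" by auto
    then have "(u, v) \<in> R"
      using all_vertices_R pverts_difference_graph by metis
    then show "u \<rightarrow>\<^sup>*\<^bsub>with_proj (mk_symmetric (with_proj ?D))\<^esub> v"
      using reach uv reachable_mk_symmetricI by blast
  qed
  then show ?thesis by (simp add: connected_def)
qed

end

section \<open>The direct product of three groups\<close>

theorem theorem6p1:
  fixes G1 :: "('a, 'm) monoid_scheme"
    and G2 :: "('b, 'n) monoid_scheme"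
    and G3 :: "('c, 'k) monoid_scheme"
  assumes "group G1" "finite (carrier G1)" "\<not> trivial_group G1"
    and "group G2" "finite (carrier G2)" "\<not> trivial_group G2"
    and "group G3" "finite (carrier G3)" "\<not> trivial_group G3"
    and "\<not> (\<exists>p::nat. Factorial_Ring.prime p \<and> p_group p (G1 \<times>\<times> G2 \<times>\<times> G3))"
  shows "Digraph_Component.connected (with_proj (difference_graph (G1 \<times>\<times> G2 \<times>\<times> G3)))"
proof -
  interpret G1: group G1 by fact
  interpret G2: group G2 by fact
  interpret G3: group G3 by fact
  let ?G = "G1 \<times>\<times> G2 \<times>\<times> G3"
  \<comment> \<open>Each \<open>P i\<close> with \<open>i < 3\<close> keeps one coordinate and
    replaces the others by identities; for larger \<open>i\<close> the map is constantly the
    identity element, a case on which the locale imposes nothing.\<close>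
  define P :: "nat \<Rightarrow> 'a \<times> 'b \<times> 'c \<Rightarrow> 'a \<times> 'b \<times> 'c" where
    "P i = (\<lambda>(x, y, z). (if i = 0 then x else \<one>\<^bsub>G1\<^esub>, if i = 1 then y else \<one>\<^bsub>G2\<^esub>,
      if i = 2 then z else \<one>\<^bsub>G3\<^esub>))" for i
  have nontrivial: "\<exists>x\<in>carrier G1. x \<noteq> \<one>\<^bsub>G1\<^esub>" "\<exists>y\<in>carrier G2. y \<noteq> \<one>\<^bsub>G2\<^esub>"
    "\<exists>z\<in>carrier G3. z \<noteq> \<one>\<^bsub>G3\<^esub>"
    using assms G1.trivial_group_subset G2.trivial_group_subset G3.trivial_group_subset by auto
  have lt3: "i < 3 \<longleftrightarrow> i = 0 \<or> i = 1 \<or> i = 2" for i :: nat by auto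
  interpret three_commuting_factors ?G P
  proof (intro three_commuting_factors.intro three_commuting_factors_axioms.intro)
    show "group ?G" using assms by (intro DirProd_group)
    show "finite (carrier ?G)" using assms by simp
    show "x = \<one>\<^bsub>?G\<^esub>" if "x \<in> carrier ?G" "\<And>i. i < 3 \<Longrightarrow> P i x = \<one>\<^bsub>?G\<^esub>" for x
      using that(2)[of 0] that(2)[of 1] that(2)[of 2] by (cases x) (simp add: P_def)
    show "\<exists>x\<in>carrier ?G. P i x \<noteq> \<one>\<^bsub>?G\<^esub>" if "i < 3" for i
    proof -
      \<comment> \<open>One triple with all three coordinates nontrivial serves for every
        \<open>i\<close>.\<close>
      obtain x y z where "x \<in> carrier G1" "x \<noteq> \<one>\<^bsub>G1\<^esub>" "y \<in> carrier G2" "y \<noteq> \<one>\<^bsub>G2\<^esub>"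
        "z \<in> carrier G3" "z \<noteq> \<one>\<^bsub>G3\<^esub>"
        using nontrivial by blast
      then show ?thesis
        using that by (intro bexI[of _ "(x, y, z)"]) (auto simp: P_def lt3)
    qed
  qed (auto simp: P_def hom_def)
  show ?thesis
    using assms(10) by (rule connected_difference_graph)
qed

end
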